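(* Let $G$ be a strongly topological rough group. If $G$ (with the topology $\tau_G$) is a $T_0$-space, then $G$ is Hausdorff.
   Context: An approximation space $(U,R)$ is a non-empty set $U$ with an equivalence relation $R$; for $X\subset U$ the upper approximation is $\overline{X}=\{x\in U:[x]_R\cap X\neq\emptyset\}$, where $[x]_R$ is the equivalence class of $x$. Let $U$ carry a binary operation, written $xy$. A subset $G\subset U$ is a rough group if: (1) $xy\in\overline{G}$ for all $x,y\in G$; (2) $(xy)z=x(yz)$ for all $x,y,z\in\overline{G}$; (3) there is $e\in\overline{G}$ (the rough identity element) with $ex=xe=x$ for all $x\in\overline{G}$; (4) for every $x\in G$ there is $y\in G$ with $xy=yx=e$ (written $y=x^{-1}$). A topological rough group is a rough group $G$ together with a topology $\tau$ on $\overline{G}$ such that, with $\tau_G$ the subspace topology on $G$, the multiplication $G\times G\to\overline{G}$, $(x,y)\mapsto xy$, is continuous (product topology of $\tau_G$ on $G\times G$, $\tau$ on $\overline{G}$) and the inverse mapping $G\to G$, $x\mapsto x^{-1}$, is continuous for $\tau_G$. Put $G_0^3=\{(x,y,z)\in G\times G\times G: xyz\in\overline{G}\}$. A strongly topological rough group is a topological rough group $G$ such that the mapping $h:G_0^3\to\overline{G}$, $h(x,y,z)=xyz$, is continuous, where $G_0^3$ carries the subspace topology from the product $G\times G\times G$ (each factor with $\tau_G$) and $\overline{G}$ carries $\tau$. *)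

theory Defs
  imports "HOL-Analysis.Analysis"
begin

locale approximation_space =
  fixes U :: "'a set" and R :: "('a \<times> 'a) set"
  assumes nonempty: "U \<noteq> {}"
    and equiv: "equiv U R"
begin

definition upper_approx :: "'a set \<Rightarrow> 'a set"
  where "upper_approx X = {x \<in> U. R `` {x} \<inter> X \<noteq> {}}"

lemma subset_upper_approx: "X \<subseteq> U \<Longrightarrow> X \<subseteq> upper_approx X"
  using equiv_class_self[OF equiv] unfolding upper_approx_def by blast

end

locale rough_group = approximation_space U R
  for U :: "'a set" and R :: "('a \<times> 'a) set" +
  fixes mult :: "'a \<Rightarrow> 'a \<Rightarrow> 'a" (infixl "\<cdot>" 70)
    and G :: "'a set"
  assumes mult_closed: "x \<in> U \<Longrightarrow> y \<in> U \<Longrightarrow> x \<cdot> y \<in> U"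
    and subset: "G \<subseteq> U"
    and mult_upper: "x \<in> G \<Longrightarrow> y \<in> G \<Longrightarrow> x \<cdot> y \<in> upper_approx G"
    and assoc: "x \<in> upper_approx G \<Longrightarrow> y \<in> upper_approx G \<Longrightarrow> z \<in> upper_approx G
                  \<Longrightarrow> (x \<cdot> y) \<cdot> z = x \<cdot> (y \<cdot> z)"
    and identity_inverse:
      "\<exists>e \<in> upper_approx G. (\<forall>x \<in> upper_approx G. e \<cdot> x = x \<and> x \<cdot> e = x) \<and>
         (\<forall>x \<in> G. \<exists>y \<in> G. x \<cdot> y = e \<and> y \<cdot> x = e)"
begin

definition rough_one :: 'a
  where "rough_one = (THE e. e \<in> upper_approx G \<and> (\<forall>x \<in> upper_approx G. e \<cdot> x = x \<and> x \<cdot> e = x))"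

definition rough_inv :: "'a \<Rightarrow> 'a"
  where "rough_inv x = (THE y. y \<in> G \<and> x \<cdot> y = rough_one \<and> y \<cdot> x = rough_one)"

text \<open>The following lemmas show that both descriptions denote.\<close>

lemma rough_one_eqI:
  assumes "e \<in> upper_approx G" "\<forall>x \<in> upper_approx G. e \<cdot> x = x \<and> x \<cdot> e = x"
  shows "rough_one = e"
  unfolding rough_one_def using assms by (intro the_equality) metis+

lemma rough_one_closed: "rough_one \<in> upper_approx G"
  and rough_one_left: "x \<in> upper_approx G \<Longrightarrow> rough_one \<cdot> x = x"
  and rough_one_right: "x \<in> upper_approx G \<Longrightarrow> x \<cdot> rough_one = x"
  and rough_inverse_exists: "x \<in> G \<Longrightarrow> \<exists>y \<in> G. x \<cdot> y = rough_one \<and> y \<cdot> x = rough_one"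
  using identity_inverse rough_one_eqI by metis+

lemma rough_inv_eqI:
  assumes x: "x \<in> G" and y: "y \<in> G" "x \<cdot> y = rough_one" "y \<cdot> x = rough_one"
  shows "rough_inv x = y"
  unfolding rough_inv_def
proof (rule the_equality)
  fix z assume z: "z \<in> G \<and> x \<cdot> z = rough_one \<and> z \<cdot> x = rough_one"
  have up: "x \<in> upper_approx G" "y \<in> upper_approx G" "z \<in> upper_approx G"
    using x y z subset_upper_approx[OF subset] by auto
  then show "z = y"
    using y z assoc[of z x y] rough_one_left rough_one_right by metis
qed (use y in simp)

lemma rough_inv_closed: "x \<in> G \<Longrightarrow> rough_inv x \<in> G"
  and rough_inv_right: "x \<in> G \<Longrightarrow> x \<cdot> rough_inv x = rough_one"
  and rough_inv_left: "x \<in> G \<Longrightarrow> rough_inv x \<cdot> x = rough_one"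
  using rough_inverse_exists rough_inv_eqI by metis+

end

locale topological_rough_group = rough_group U R mult G
  for U :: "'a set" and R :: "('a \<times> 'a) set"
    and mult :: "'a \<Rightarrow> 'a \<Rightarrow> 'a" (infixl "\<cdot>" 70) and G :: "'a set" +
  fixes \<tau> :: "'a topology"
  assumes topspace_upper: "topspace \<tau> = upper_approx G"
    and continuous_mult:
      "continuous_map (prod_topology (subtopology \<tau> G) (subtopology \<tau> G)) \<tau> (\<lambda>(x, y). x \<cdot> y)"
    and continuous_inv: "continuous_map (subtopology \<tau> G) (subtopology \<tau> G) rough_inv"

text \<open>For factors in \<open>G\<close> the product \<open>xyz\<close> does not depend on the bracketing, by associativity on
  the upper approximation.\<close>

locale strongly_topological_rough_group = topological_rough_group U R mult G \<tau>
  for U :: "'a set" and R :: "('a \<times> 'a) set"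
    and mult :: "'a \<Rightarrow> 'a \<Rightarrow> 'a" (infixl "\<cdot>" 70) and G :: "'a set" and \<tau> :: "'a topology" +
  assumes continuous_triple_mult:
    "continuous_map
       (subtopology
          (prod_topology (subtopology \<tau> G) (prod_topology (subtopology \<tau> G) (subtopology \<tau> G)))
          {(x, y, z) \<in> G \<times> G \<times> G. x \<cdot> y \<cdot> z \<in> upper_approx G})
       \<tau> (\<lambda>(x, y, z). x \<cdot> y \<cdot> z)"

end

theory Submission
  imports Defs
begin

text \<open>If an open \<open>V\<close> contains \<open>a\<close> but not \<open>b\<close>, then \<open>(x, y) \<mapsto> x y\<inverse> b\<close> sends \<open>(a, b)\<close> into \<open>V\<close>,
  hence by continuity it sends the part of some \<open>A \<times> B\<close> where it is defined into \<open>V\<close>. It is defined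
  on the whole diagonal, where its value is \<open>b\<close>; so \<open>A\<close> and \<open>B\<close> are disjoint. The identity need not
  lie in \<open>G\<close>, so one cannot translate to it as in a topological group.\<close>

context strongly_topological_rough_group
begin

lemma in_upper: "x \<in> G \<Longrightarrow> x \<in> upper_approx G"
  using subset_upper_approx[OF subset] by blast

lemma topspace_rough_group: "topspace (subtopology \<tau> G) = G"
  using topspace_upper in_upper by auto

lemma mult_rough_inv_cancel_left: "x \<in> G \<Longrightarrow> y \<in> G \<Longrightarrow> x \<cdot> rough_inv x \<cdot> y = y"
  by (simp add: rough_inv_right rough_one_left in_upper)

lemma mult_rough_inv_cancel_right: "x \<in> G \<Longrightarrow> y \<in> G \<Longrightarrow> x \<cdot> rough_inv y \<cdot> y = x"
  by (simp add: assoc rough_inv_closed rough_inv_left rough_one_right in_upper)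

text \<open>The product of \<open>x\<close> and \<open>rough_inv y\<close> may leave
  \<open>G\<close>, where continuity of the binary multiplication no longer applies. Hence the map
  is factored as the triple product after \<open>(x, y)\<close> \<mapsto>
  \<open>(x, rough_inv y, b)\<close>.\<close>

lemma continuous_map_mult_inv_mult:
  assumes b: "b \<in> G"
  shows "continuous_map
    (subtopology (prod_topology (subtopology \<tau> G) (subtopology \<tau> G))
       {(x, y) \<in> G \<times> G. x \<cdot> rough_inv y \<cdot> b \<in> upper_approx G})
    \<tau> (\<lambda>(x, y). x \<cdot> rough_inv y \<cdot> b)"
proof -
  let ?X = "subtopology \<tau> G"
  let ?S = "{(x, y) \<in> G \<times> G. x \<cdot> rough_inv y \<cdot> b \<in> upper_approx G}"
  let ?T = "{(x, y, z) \<in> G \<times> G \<times> G. x \<cdot> y \<cdot> z \<in> upper_approx G}"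
  let ?f = "\<lambda>p. (fst p, rough_inv (snd p), b)"
  have "continuous_map (prod_topology ?X ?X) (prod_topology ?X (prod_topology ?X ?X)) ?f"
  proof (intro continuous_map_pairedI)
    show "continuous_map (prod_topology ?X ?X) ?X (\<lambda>p. rough_inv (snd p))"
      using continuous_map_compose[OF continuous_map_snd continuous_inv] by (simp add: o_def)
    show "continuous_map (prod_topology ?X ?X) ?X (\<lambda>p. b)"
      using b topspace_rough_group by (simp only: continuous_map_const) simp
  qed (rule continuous_map_fst)
  \<comment> \<open>Restricting to \<open>?S\<close> is what makes \<open>?f\<close> land in
    \<open>?T\<close>, the domain of the triple product.\<close>
  then have "continuous_map (subtopology (prod_topology ?X ?X) ?S)
      (subtopology (prod_topology ?X (prod_topology ?X ?X)) ?T) ?f"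
    by (rule continuous_map_into_subtopology[OF continuous_map_from_subtopology])
      (use b rough_inv_closed in force)
  from continuous_map_compose[OF this continuous_triple_mult] show ?thesis
    by (simp add: o_def case_prod_unfold)
qed

text \<open>One-sided separation is all that T0 provides, while the conclusion is symmetric in
  \<open>a\<close> and \<open>b\<close>.\<close>

lemma disjoint_nhds_if_separated:
  assumes a: "a \<in> G" and b: "b \<in> G" and V: "openin \<tau> V" "a \<in> V" "b \<notin> V"
  shows "\<exists>A B. openin (subtopology \<tau> G) A \<and> openin (subtopology \<tau> G) B \<and>
    a \<in> A \<and> b \<in> B \<and> disjnt A B"
proof -
  let ?X = "subtopology \<tau> G"
  let ?S = "{(x, y) \<in> G \<times> G. x \<cdot> rough_inv y \<cdot> b \<in> upper_approx G}"
  have top: "topspace (subtopology (prod_topology ?X ?X) ?S) = ?S"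
    by (auto simp: topspace_upper in_upper)
  have "openin (subtopology (prod_topology ?X ?X) ?S)
      {p \<in> ?S. (\<lambda>(x, y). x \<cdot> rough_inv y \<cdot> b) p \<in> V}"
    using openin_continuous_map_preimage[OF continuous_map_mult_inv_mult[OF b] V(1)]
    unfolding top .
  \<comment> \<open>The set \<open>?S\<close> need not be open, so boxes are taken inside an open
    \<open>W\<close> of the full product and may stick out of \<open>?S\<close>.\<close>
  then obtain W where W: "openin (prod_topology ?X ?X) W"
    and W_eq: "{p \<in> ?S. (\<lambda>(x, y). x \<cdot> rough_inv y \<cdot> b) p \<in> V} = W \<inter> ?S"
    by (subst (asm) openin_subtopology) (elim exE conjE, rule that)
  have "(a, b) \<in> {p \<in> ?S. (\<lambda>(x, y). x \<cdot> rough_inv y \<cdot> b) p \<in> V}"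
    using a b V by (simp add: mult_rough_inv_cancel_right in_upper)
  then have "(a, b) \<in> W"
    unfolding W_eq by blast
  then obtain A B where AB: "openin ?X A" "openin ?X B" "a \<in> A" "b \<in> B" "A \<times> B \<subseteq> W"
    using W[unfolded openin_prod_topology_alt, rule_format] by meson
  have "c \<notin> B" if "c \<in> A" for c
  proof
    assume "c \<in> B"
    have c: "c \<in> G"
      using openin_subset[OF AB(1)] that topspace_rough_group by blast
    \<comment> \<open>The diagonal lies in \<open>?S\<close> because the product there collapses to
      \<open>b\<close>; so a common point of \<open>A\<close> and \<open>B\<close> would put
      \<open>b\<close> into \<open>V\<close>.\<close>
    then have "(c, c) \<in> W \<inter> ?S"
      using AB(5) that \<open>c \<in> B\<close> b by (auto simp: mult_rough_inv_cancel_left in_upper)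
    then have "c \<cdot> rough_inv c \<cdot> b \<in> V"
      unfolding W_eq[symmetric] by simp
    then show False
      using V(3) b c by (simp add: mult_rough_inv_cancel_left)
  qed
  then show ?thesis
    using AB unfolding disjnt_iff by blast
qed

lemma Hausdorff_if_t0:
  assumes "t0_space (subtopology \<tau> G)"
  shows "Hausdorff_space (subtopology \<tau> G)"
  unfolding Hausdorff_space_def topspace_rough_group
proof (intro allI impI)
  fix a b assume ab: "a \<in> G \<and> b \<in> G \<and> a \<noteq> b"
  then obtain O' where "openin (subtopology \<tau> G) O'" and O': "a \<notin> O' \<longleftrightarrow> b \<in> O'"
    using assms unfolding t0_space_def topspace_rough_group by blast
  then obtain V where V: "openin \<tau> V" "O' = V \<inter> G"
    unfolding openin_subtopology by blast
  \<comment> \<open>T0 does not tell which of the two points the open set contains; the second case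
    exchanges their roles.\<close>
  consider "a \<in> V" "b \<notin> V" | "b \<in> V" "a \<notin> V"
    using O' V(2) ab by auto
  then show "\<exists>A B. openin (subtopology \<tau> G) A \<and> openin (subtopology \<tau> G) B \<and>
      a \<in> A \<and> b \<in> B \<and> disjnt A B"
  proof cases
    case 1
    then show ?thesis
      using disjoint_nhds_if_separated ab V(1) by blast
  next
    case 2
    then show ?thesis
      using disjoint_nhds_if_separated[of b a V] ab V(1) disjnt_sym by blast
  qed
qed

end

theorem theorem3p14:
  fixes U :: "'a set" and R :: "('a \<times> 'a) set" and mult :: "'a \<Rightarrow> 'a \<Rightarrow> 'a"
    and G :: "'a set" and \<tau> :: "'a topology"
  assumes "strongly_topological_rough_group U R mult G \<tau>"
    and "t0_space (subtopology \<tau> G)"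
  shows "Hausdorff_space (subtopology \<tau> G)"
  using assms by (rule strongly_topological_rough_group.Hausdorff_if_t0)

end
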